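(* Let $X_1,\dots,X_n$ be nonempty sets and $\mathbb{X}_n=\prod_{i=1}^nX_i$. The generalized Lancaster interaction $\Lambda_k^n$, $1\le k\le n$, satisfies the following properties: (i) For discrete probabilities $P,Q$ in $\mathbb{X}_n$, $\Lambda_k^n[P,Q]\in\mathcal{M}_k(\mathbb{X}_n)$. (ii) Let $P$ be a discrete probability in $\mathbb{X}_n$. If for some $1\le k\le n-1$ we have $\Lambda_k^n[P]=0$, then $\Lambda_{k+1}^n[P]=0$. (iii) $\Lambda_n^n[P]$ is multiplicative, in the sense that if $P$ is a discrete probability in $\mathbb{X}_n$ with $P=P_\pi$ for some partition $\pi=\{F_1,\dots,F_\ell\}$ of $\{1,\dots,n\}$, then $$\Lambda_n^n[P]=\mathop{\times}_{i=1}^\ell\Lambda_{|F_i|}^{|F_i|}[P_{F_i}].$$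
   Context: A discrete measure in a set is a finite real linear combination of Dirac measures. For $0\le k\le n$, $\mathcal{M}_k(\mathbb{X}_n)$ is the vector space of discrete measures $\mu$ in $\mathbb{X}_n$ such that $\mu(\prod_{i=1}^nA_i)=0$ for all $A_i\subset X_i$ with $|\{i:A_i=X_i\}|\ge n-k+1$. For a discrete probability $P$ in $\mathbb{X}_n$ and $F\subset\{1,\dots,n\}$, $P_F$ is the marginal of $P$ on $\prod_{i\in F}X_i$ and $P_i=P_{\{i\}}$; products such as $P_F\times Q_{F^c}$ are measures in $\mathbb{X}_n$ with coordinates in their original positions (factors indexed by the empty set are omitted). For a partition $\pi=\{F_1,\dots,F_\ell\}$, $P_\pi:=\mathop{\times}_{i=1}^\ell P_{F_i}$. For discrete probabilities $P,Q$ in $\mathbb{X}_n$, $$\Lambda_k^n[P,Q]:=P+\sum_{j=0}^{k-1}(-1)^{k-j}\binom{n-j-1}{n-k}\sum_{|F|=j}P_F\times Q_{F^c},$$ and $\Lambda_k^n[P]:=\Lambda_k^n[P,Q]$ with $Q=\mathop{\times}_{i=1}^nP_i$. The interaction $\Lambda_{|F|}^{|F|}[P_F]$ is defined in the same way for the probability $P_F$ in the product $\prod_{i\in F}X_i$ of $|F|$ sets. *)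

theory Defs
  imports Complex_Main "HOL-Library.FuncSet" "HOL-Library.Disjoint_Sets"
    "HOL-Library.Indicator_Function"
begin

text \<open>
  Signed discrete measures are real-valued set functions defined on all subsets of the ambient
  type. A measure in a set \<open>S\<close> is carried by \<open>S\<close>, so its values on arbitrary sets are determined
  by its values on subsets of \<open>S\<close>, and equality of set functions is equality of measures.

  The product of the sets \<open>X i\<close>, \<open>i \<in> I\<close>, is the set of extensional functions \<open>Pi\<^sub>E I X\<close>. Working
  over an arbitrary finite index set \<open>I\<close> keeps coordinates in their original positions and covers
  the subproducts over \<open>F \<subseteq> I\<close>.
\<close>

definition dirac :: "'b \<Rightarrow> 'b set \<Rightarrow> real" where
  "dirac x A = indicator A x"

definition discrete_measure :: "'b set \<Rightarrow> ('b set \<Rightarrow> real) \<Rightarrow> bool" where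
  "discrete_measure S \<mu> \<longleftrightarrow>
     (\<exists>T c. finite T \<and> T \<subseteq> S \<and> \<mu> = (\<lambda>A. \<Sum>x\<in>T. c x * dirac x A))"

definition discrete_prob :: "'b set \<Rightarrow> ('b set \<Rightarrow> real) \<Rightarrow> bool" where
  "discrete_prob S P \<longleftrightarrow> discrete_measure S P \<and> (\<forall>A. 0 \<le> P A) \<and> P S = 1"

definition M_space :: "'i set \<Rightarrow> ('i \<Rightarrow> 'a set) \<Rightarrow> nat \<Rightarrow> (('i \<Rightarrow> 'a) set \<Rightarrow> real) set" where
  "M_space I X k =
     {\<mu>. discrete_measure (Pi\<^sub>E I X) \<mu> \<and>
         (\<forall>A. (\<forall>i\<in>I. A i \<subseteq> X i) \<and> card {i \<in> I. A i = X i} \<ge> card I - k + 1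
              \<longrightarrow> \<mu> (Pi\<^sub>E I A) = 0)}"

definition marginal ::
  "'i set \<Rightarrow> ('i \<Rightarrow> 'a set) \<Rightarrow> (('i \<Rightarrow> 'a) set \<Rightarrow> real) \<Rightarrow> 'i set \<Rightarrow> ('i \<Rightarrow> 'a) set \<Rightarrow> real" where
  "marginal I X P F A = P {x \<in> Pi\<^sub>E I X. restrict x F \<in> A}"

text \<open>
  The product of discrete measures gives the point \<open>x\<close> the product of the masses of its
  projections. Only points of nonzero mass are summed, which keeps the sums finite when the
  sets \<open>X i\<close> are infinite.

  A probability on the empty product has mass 1 at its only point, so it acts as a neutral
  factor; this realises the convention that factors indexed by the empty set are omitted.
\<close>

definition times_measure ::
  "('i \<Rightarrow> 'a set) \<Rightarrow> 'i set \<Rightarrow> 'i set \<Rightarrow> (('i \<Rightarrow> 'a) set \<Rightarrow> real) \<Rightarrow> (('i \<Rightarrow> 'a) set \<Rightarrow> real)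
     \<Rightarrow> ('i \<Rightarrow> 'a) set \<Rightarrow> real" where
  "times_measure X F G \<mu> \<nu> A =
     (\<Sum>x | x \<in> A \<inter> Pi\<^sub>E (F \<union> G) X \<and> \<mu> {restrict x F} * \<nu> {restrict x G} \<noteq> 0.
        \<mu> {restrict x F} * \<nu> {restrict x G})"

definition Times_measure ::
  "('i \<Rightarrow> 'a set) \<Rightarrow> 'i set set \<Rightarrow> ('i set \<Rightarrow> ('i \<Rightarrow> 'a) set \<Rightarrow> real)
     \<Rightarrow> ('i \<Rightarrow> 'a) set \<Rightarrow> real" where
  "Times_measure X \<pi> m A =
     (\<Sum>x | x \<in> A \<inter> Pi\<^sub>E (\<Union>\<pi>) X \<and> (\<Prod>F\<in>\<pi>. m F {restrict x F}) \<noteq> 0.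
        \<Prod>F\<in>\<pi>. m F {restrict x F})"

definition partition_product ::
  "'i set \<Rightarrow> ('i \<Rightarrow> 'a set) \<Rightarrow> (('i \<Rightarrow> 'a) set \<Rightarrow> real) \<Rightarrow> 'i set set
     \<Rightarrow> ('i \<Rightarrow> 'a) set \<Rightarrow> real" where
  "partition_product I X P \<pi> = Times_measure X \<pi> (marginal I X P)"

definition Lancaster2 ::
  "'i set \<Rightarrow> ('i \<Rightarrow> 'a set) \<Rightarrow> nat \<Rightarrow> (('i \<Rightarrow> 'a) set \<Rightarrow> real) \<Rightarrow> (('i \<Rightarrow> 'a) set \<Rightarrow> real)
     \<Rightarrow> ('i \<Rightarrow> 'a) set \<Rightarrow> real" where
  "Lancaster2 I X k P Q A =
     P A + (\<Sum>j = 0..<k. (-1) ^ (k - j) * real ((card I - j - 1) choose (card I - k)) *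
              (\<Sum>F | F \<subseteq> I \<and> card F = j.
                 times_measure X F (I - F) (marginal I X P F) (marginal I X Q (I - F)) A))"

definition Lancaster ::
  "'i set \<Rightarrow> ('i \<Rightarrow> 'a set) \<Rightarrow> nat \<Rightarrow> (('i \<Rightarrow> 'a) set \<Rightarrow> real) \<Rightarrow> ('i \<Rightarrow> 'a) set \<Rightarrow> real" where
  "Lancaster I X k P = Lancaster2 I X k P (partition_product I X P ((\<lambda>i. {i}) ` I))"

end

theory Submission
  imports Defs
begin

text \<open>
  Write \<open>n\<close> for the number of coordinates and \<open>E\<^sub>F\<close> for \<open>P\<^sub>F \<times> Q\<^sub>F'\<close>, where \<open>F'\<close> is the complement
  of \<open>F\<close>. Two observations carry the whole proof.

  The first is that the interaction is a single sum over all subsets: with the polynomial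
  coefficient \<open>c\<^sub>k(j) = (-1)^(k + j) * gbinomial (n - 1 - j) (n - k)\<close> one has \<open>\<Lambda>\<^sub>k = (\<Sum>F. c\<^sub>k(card F) E\<^sub>F)\<close>,
  because \<open>c\<^sub>k\<close> vanishes for \<open>k \<le> j < n\<close> and equals 1 at \<open>j = n\<close>, where \<open>E\<^sub>F = P\<close>. Summing over all
  \<open>F\<close> with a prescribed trace \<open>F \<inter> S\<close> therefore takes a finite difference of order \<open>n - card S\<close> of a
  polynomial of degree \<open>n - k\<close>: the result is 0 when \<open>card S < k\<close> and the sign
  \<open>(-1)^(k + card T)\<close>, \<open>T\<close> being the trace, when \<open>card S = k\<close> (\<open>lancaster_coeff_sum_trace\<close>).

  The second is that \<open>E\<^sub>F\<close> is the image of \<open>P \<times> Q\<close> under the map that takes the coordinates in \<open>F\<close>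
  from the first point and the others from the second (\<open>hybrid_eq_sum\<close>).

  For membership in \<open>M_space\<close>, let \<open>S\<close> be the set of the fewer than \<open>k\<close> coordinates in which the rectangle is a proper
  subset. Whether a mixed point lies in the rectangle depends on \<open>F\<close> only through \<open>F \<inter> S\<close>, so the
  sum over \<open>F\<close> vanishes already for each pair of points (\<open>Lancaster2_in_M_space\<close>).

  For the step from \<open>k\<close> to \<open>k + 1\<close>, \<open>Q\<close> is a product, hence resampling the coordinates outside \<open>G\<close> from \<open>Q\<close> turns \<open>E\<^sub>F\<close>
  into the same expression for \<open>F \<inter> G\<close>. Applied to \<open>\<Lambda>\<^sub>k = 0\<close> with \<open>card G = k\<close> this gives
  \<open>(\<Sum>T\<subseteq>G. (-1)^(k + card T) E\<^sub>T) = 0\<close> (\<open>Lancaster_zero_imp_face_sum_zero\<close>). By Pascal's rule for the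
  coefficients, \<open>\<Lambda>\<close> for \<open>k + 1\<close> is \<open>\<Lambda>\<^sub>k\<close> minus the sum of these expressions over all \<open>G\<close> of size \<open>k\<close>
  (\<open>Lancaster_Suc\<close>).

  For multiplicativity, note that \<open>\<Lambda>\<^sub>n\<close> gives a point \<open>x\<close> the mass \<open>\<Sum>F. P\<^sub>F(x) (\<Prod>i\<notin>F. - P\<^sub>i(x))\<close>. If \<open>P\<close> is a product
  over the blocks of a partition, each summand is a product over the blocks \<open>B\<close> of factors that
  depend on \<open>F \<inter> B\<close> only, and the sum of products is the product of the blockwise sums.
\<close>

section \<open>Alternating sums over subsets\<close>

lemma sum_Pow_insert:
  fixes f :: "'i set \<Rightarrow> 'b::comm_monoid_add"
  assumes "finite W" and "w \<notin> W"
  shows "(\<Sum>U\<in>Pow (insert w W). f U) = (\<Sum>U\<in>Pow W. f U + f (insert w U))"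
proof -
  have "inj_on (insert w) (Pow W)"
    using assms(2) by (auto simp: inj_on_def)
  moreover have "Pow W \<inter> insert w ` Pow W = {}"
    using assms(2) by auto
  ultimately show ?thesis
    using assms(1) by (simp add: Pow_insert sum.union_disjoint sum.reindex sum.distrib)
qed

text \<open>
  The left-hand side is the backward difference of order \<open>card W\<close> of \<open>x \<mapsto> gbinomial x r\<close>, and every
  single difference lowers \<open>r\<close> by one (Pascal's rule). Indexing it by the subsets of \<open>W\<close> instead of
  their sizes absorbs the binomial weights, so that the induction adds one element to \<open>W\<close>.
\<close>

lemma alternating_gbinomial_sum:
  fixes a :: real
  assumes "finite W"
  shows "(\<Sum>U\<in>Pow W. (-1) ^ card U * ((a - real (card U)) gchoose r)) =
         (if card W \<le> r then (a - real (card W)) gchoose (r - card W) else 0)"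
  using assms
proof (induction W arbitrary: a r rule: finite_induct)
  case empty
  then show ?case by simp
next
  case (insert w W)
  have step: "(\<Sum>U\<in>Pow (insert w W). (-1) ^ card U * ((a - real (card U)) gchoose r)) =
      (\<Sum>U\<in>Pow W. (-1) ^ card U * (((a - real (card U)) gchoose r) - ((a - 1 - real (card U)) gchoose r)))"
    unfolding sum_Pow_insert[OF insert.hyps]
  proof (rule sum.cong[OF refl])
    fix U assume "U \<in> Pow W"
    then have "finite U" "w \<notin> U"
      using insert.hyps finite_subset by auto
    then have "card (insert w U) = Suc (card U)"
      by simp
    then show "(-1) ^ card U * ((a - real (card U)) gchoose r) +
        (-1) ^ card (insert w U) * ((a - real (card (insert w U))) gchoose r) =
        (-1) ^ card U * (((a - real (card U)) gchoose r) - ((a - 1 - real (card U)) gchoose r))"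
      by (simp add: algebra_simps diff_diff_eq)
  qed
  show ?case
  proof (cases r)
    case 0
    then show ?thesis
      unfolding step using insert.hyps by simp
  next
    case (Suc r')
    have "((a - real u) gchoose r) - ((a - 1 - real u) gchoose r) = (a - 1 - real u) gchoose r'" for u
      using gbinomial_Suc_Suc[of "a - 1 - real u" r'] by (simp add: Suc)
    then show ?thesis
      using insert.hyps insert.IH[of "a - 1" r'] unfolding step by (simp add: Suc diff_diff_eq)
  qed
qed

text \<open>
  Up to the sign \<open>(-1)^(k + j)\<close> this is a polynomial of degree \<open>n - k\<close> in \<open>j\<close>, and it is meaningful for all
  \<open>j \<le> n\<close>: it extends the coefficients of the interaction, given for \<open>j < k\<close> only, so
  that the isolated term \<open>P\<close> becomes the summand for the full index set.
\<close>

definition lancaster_coeff :: "nat \<Rightarrow> nat \<Rightarrow> nat \<Rightarrow> real" where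
  "lancaster_coeff n k j = (-1) ^ (k + j) * ((real n - 1 - real j) gchoose (n - k))"

lemma lancaster_coeff_less:
  assumes "j < k" and "k \<le> n"
  shows "lancaster_coeff n k j = (-1) ^ (k - j) * real ((n - j - 1) choose (n - k))"
proof -
  have "real n - 1 - real j = real (n - j - 1)"
    using assms by simp
  moreover have "(-1 :: real) ^ (k + j) = (-1) ^ (k - j)"
    using assms by (simp add: minus_one_power_iff)
  ultimately show ?thesis
    by (simp add: lancaster_coeff_def binomial_gbinomial)
qed

lemma lancaster_coeff_between:
  assumes "k \<le> j" and "j < n"
  shows "lancaster_coeff n k j = 0"
proof -
  have "real n - 1 - real j = real (n - j - 1)"
    using assms by simp
  moreover have "(n - j - 1) choose (n - k) = 0"
    using assms by simp
  ultimately show ?thesis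
    by (simp add: lancaster_coeff_def binomial_gbinomial[symmetric] del: of_nat_diff)
qed

lemma lancaster_coeff_top:
  assumes "k \<le> n"
  shows "lancaster_coeff n k n = 1"
proof -
  have "((-1 :: real) gchoose (n - k)) = (-1) ^ (n - k)"
    using gbinomial_minus[of "1::real" "n - k"] binomial_gbinomial[of "n-k" "n-k", where ?'a=real]
    by simp
  then show ?thesis
    using assms by (simp add: lancaster_coeff_def power_add[symmetric])
qed

text \<open>
  This is Pascal's rule; the correction term counts the sets of size \<open>k\<close> between a given set of
  size \<open>j\<close> and the full index set (\<open>card_intermediate_sets\<close>).
\<close>

lemma lancaster_coeff_Suc:
  assumes "k < n" and "j \<le> n"
  shows "lancaster_coeff n (Suc k) j =
         lancaster_coeff n k j - (-1) ^ (k + j) * real ((n - j) choose (n - k))"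
proof -
  obtain m where m: "n - k = Suc m" "n - Suc k = m"
    using assms(1) by (metis Suc_diff_Suc)
  have "real (n - j) = (real n - 1 - real j) + 1"
    using assms(2) by simp
  then have "real ((n - j) choose (n - k)) =
      ((real n - 1 - real j) gchoose m) + ((real n - 1 - real j) gchoose Suc m)"
    by (simp only: binomial_gbinomial gbinomial_Suc_Suc m)
  then show ?thesis
    by (simp add: lancaster_coeff_def m algebra_simps)
qed

lemma sum_Pow_split:
  fixes h :: "'i set \<Rightarrow> 'b::comm_monoid_add"
  assumes "S \<subseteq> I"
  shows "(\<Sum>F\<in>Pow I. h F) = (\<Sum>T\<in>Pow S. \<Sum>U\<in>Pow (I - S). h (T \<union> U))"
proof -
  have "(\<Sum>F\<in>Pow I. h F) = (\<Sum>(T, U)\<in>Pow S \<times> Pow (I - S). h (T \<union> U))"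
    by (rule sum.reindex_bij_witness
          [where i = "\<lambda>(T, U). T \<union> U" and j = "\<lambda>F. (F \<inter> S, F - S)"])
       (use assms in \<open>auto intro: arg_cong[where f = h]\<close>)
  then show ?thesis
    by (simp add: sum.cartesian_product)
qed

text \<open>
  For a fixed trace \<open>T = F \<inter> S\<close> the coefficients are summed over the free part \<open>F - S\<close>, which is a
  difference of order \<open>card I - card S\<close> of a polynomial of degree \<open>card I - k\<close>. It is zero if
  \<open>card S < k\<close>, and if \<open>card S = k\<close> the order equals the degree, so that only the sign is left.
\<close>

lemma lancaster_coeff_sum_trace:
  assumes "finite I" and "S \<subseteq> I" and "card S \<le> k" and "k \<le> card I"
  shows "(\<Sum>F\<in>Pow I. lancaster_coeff (card I) k (card F) * f (F \<inter> S)) =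
         (if card S = k then (\<Sum>T\<in>Pow S. (-1) ^ (k + card T) * f T) else 0)"
proof -
  let ?n = "card I"
  have fin: "finite S" "finite (I - S)"
    using assms finite_subset by auto
  have card: "card (I - S) = ?n - card S"
    using assms fin by (simp add: card_Diff_subset)
  have le: "card S \<le> ?n"
    using assms by (simp add: card_mono)
  have inner: "(\<Sum>U\<in>Pow (I - S). lancaster_coeff ?n k (card (T \<union> U))) =
      (if card S = k then (-1) ^ (k + card T) else 0)" if T: "T \<in> Pow S" for T
  proof -
    have "(\<Sum>U\<in>Pow (I - S). lancaster_coeff ?n k (card (T \<union> U))) =
        (\<Sum>U\<in>Pow (I - S). (-1) ^ (k + card T) *
          ((-1) ^ card U * ((real ?n - 1 - real (card T) - real (card U)) gchoose (?n - k))))"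
    proof (rule sum.cong[OF refl])
      fix U assume "U \<in> Pow (I - S)"
      then have "card (T \<union> U) = card T + card U"
        using T fin by (intro card_Un_disjoint) (auto intro: finite_subset)
      then show "lancaster_coeff ?n k (card (T \<union> U)) = (-1) ^ (k + card T) *
          ((-1) ^ card U * ((real ?n - 1 - real (card T) - real (card U)) gchoose (?n - k)))"
        by (simp add: lancaster_coeff_def power_add diff_diff_eq add.assoc)
    qed
    also have "\<dots> = (if card S = k then (-1) ^ (k + card T) else 0)"
      unfolding sum_distrib_left[symmetric] alternating_gbinomial_sum[OF fin(2)] card
      using assms le by auto
    finally show ?thesis .
  qed
  have "(\<Sum>F\<in>Pow I. lancaster_coeff ?n k (card F) * f (F \<inter> S)) =
      (\<Sum>T\<in>Pow S. \<Sum>U\<in>Pow (I - S). lancaster_coeff ?n k (card (T \<union> U)) * f ((T \<union> U) \<inter> S))"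
    by (rule sum_Pow_split[OF assms(2)])
  also have "\<dots> = (\<Sum>T\<in>Pow S. (\<Sum>U\<in>Pow (I - S). lancaster_coeff ?n k (card (T \<union> U))) * f T)"
    unfolding sum_distrib_right
    by (intro sum.cong refl arg_cong2[where f = "(*)"] arg_cong[where f = f]) blast
  also have "\<dots> = (\<Sum>T\<in>Pow S. (if card S = k then (-1) ^ (k + card T) else 0) * f T)"
    by (intro sum.cong refl) (simp only: inner)
  finally show ?thesis
    by simp
qed

lemma card_intermediate_sets:
  assumes "finite I" and "F \<subseteq> I" and "k \<le> card I"
  shows "card {G. F \<subseteq> G \<and> G \<subseteq> I \<and> card G = k} = (card I - card F) choose (card I - k)"
proof -
  have card_compl: "card (I - H) = card I - card H" if "H \<subseteq> I" for H
    using that assms(1) by (simp add: card_Diff_subset finite_subset[OF that])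
  have "bij_betw (\<lambda>H. I - H) {H. H \<subseteq> I - F \<and> card H = card I - k}
      {G. F \<subseteq> G \<and> G \<subseteq> I \<and> card G = k}"
  proof (rule bij_betw_byWitness[where f' = "\<lambda>G. I - G"])
    show "(\<lambda>H. I - H) ` {H. H \<subseteq> I - F \<and> card H = card I - k} \<subseteq> {G. F \<subseteq> G \<and> G \<subseteq> I \<and> card G = k}"
    proof (rule image_subsetI)
      fix H assume H: "H \<in> {H. H \<subseteq> I - F \<and> card H = card I - k}"
      then have "H \<subseteq> I"
        by blast
      then show "I - H \<in> {G. F \<subseteq> G \<and> G \<subseteq> I \<and> card G = k}"
        using H card_compl assms(2,3) by auto
    qed
    show "(\<lambda>G. I - G) ` {G. F \<subseteq> G \<and> G \<subseteq> I \<and> card G = k} \<subseteq> {H. H \<subseteq> I - F \<and> card H = card I - k}"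
      using card_compl by auto
  qed auto
  then have "card {G. F \<subseteq> G \<and> G \<subseteq> I \<and> card G = k} = card {H. H \<subseteq> I - F \<and> card H = card I - k}"
    by (rule bij_betw_same_card[symmetric])
  also have "\<dots> = card (I - F) choose (card I - k)"
    using assms(1) by (intro n_subsets) simp
  finally show ?thesis
    using card_compl[OF assms(2)] by simp
qed

section \<open>Discrete measures\<close>

text \<open>
  A finite carrier together with the expansion of \<open>\<mu>\<close> into its point masses. Naming the carrier
  separately from the ambient set allows measures to be compared over a common finite carrier; the
  indicator stands inside the sum so that sums over several carriers can be exchanged.
\<close>

definition carried_by :: "'b set \<Rightarrow> ('b set \<Rightarrow> real) \<Rightarrow> bool" where
  "carried_by T \<mu> \<longleftrightarrow> finite T \<and> (\<forall>A. \<mu> A = (\<Sum>x\<in>T. of_bool (x \<in> A) * \<mu> {x}))"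

lemma carried_byD:
  assumes "carried_by T \<mu>"
  shows "\<mu> A = (\<Sum>x\<in>T. of_bool (x \<in> A) * \<mu> {x})"
  by (rule assms[unfolded carried_by_def, THEN conjunct2, rule_format])

lemma carried_by_finite: "carried_by T \<mu> \<Longrightarrow> finite T"
  by (simp add: carried_by_def)

lemma carried_by_outside:
  assumes "carried_by T \<mu>" and "x \<notin> T"
  shows "\<mu> {x} = 0"
proof -
  have "\<mu> {x} = (\<Sum>y\<in>T. of_bool (y \<in> {x}) * \<mu> {y})"
    by (rule carried_byD[OF assms(1)])
  also have "\<dots> = 0"
    using assms(2) by (intro sum.neutral) auto
  finally show ?thesis .
qed

lemma carried_by_mono:
  assumes "carried_by T \<mu>" and "T \<subseteq> T'" and "finite T'"
  shows "carried_by T' \<mu>"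
  unfolding carried_by_def
proof (intro conjI allI)
  fix A
  have "(\<Sum>x\<in>T. of_bool (x \<in> A) * \<mu> {x}) = (\<Sum>x\<in>T'. of_bool (x \<in> A) * \<mu> {x})"
    by (rule sum.mono_neutral_left) (use assms in \<open>auto simp: carried_by_outside\<close>)
  then show "\<mu> A = (\<Sum>x\<in>T'. of_bool (x \<in> A) * \<mu> {x})"
    using carried_byD[OF assms(1), of A] by (simp only:)
qed fact

lemma discrete_measure_iff_carried_by:
  "discrete_measure S \<mu> \<longleftrightarrow> (\<exists>T. T \<subseteq> S \<and> carried_by T \<mu>)"
proof
  assume "discrete_measure S \<mu>"
  then obtain T c where T: "finite T" "T \<subseteq> S" and \<mu>: "\<And>A. \<mu> A = (\<Sum>x\<in>T. c x * dirac x A)"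
    unfolding discrete_measure_def by metis
  have "\<mu> {x} = c x" if "x \<in> T" for x
    unfolding \<mu> using T(1) that by (simp add: dirac_def indicator_def)
  then have "\<mu> A = (\<Sum>x\<in>T. of_bool (x \<in> A) * \<mu> {x})" for A
    unfolding \<mu>[of A] by (intro sum.cong) (auto simp: dirac_def indicator_def)
  then have "carried_by T \<mu>"
    unfolding carried_by_def using T(1) by (intro conjI allI)
  then show "\<exists>T. T \<subseteq> S \<and> carried_by T \<mu>"
    using T(2) by blast
next
  assume "\<exists>T. T \<subseteq> S \<and> carried_by T \<mu>"
  then obtain T where T: "T \<subseteq> S" "carried_by T \<mu>"
    by blast
  have "\<mu> = (\<lambda>A. \<Sum>x\<in>T. \<mu> {x} * dirac x A)"
    by (rule ext, rule trans[OF carried_byD[OF T(2)]], rule sum.cong) (auto simp: dirac_def indicator_def)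
  then show "discrete_measure S \<mu>"
    unfolding discrete_measure_def
    by (intro exI[of _ T] exI[of _ "\<lambda>x. \<mu> {x}"] conjI carried_by_finite[OF T(2)] T(1))
qed

text \<open>
  The points \<open>f j\<close> may coincide, which is what happens for images of product measures.
\<close>

lemma discrete_measure_weighted_points:
  assumes "finite J" and "\<And>j. j \<in> J \<Longrightarrow> f j \<in> S"
    and "\<And>A. \<mu> A = (\<Sum>j\<in>J. of_bool (f j \<in> A) * c j)"
  shows "discrete_measure S \<mu>"
  unfolding discrete_measure_def
proof (intro exI conjI)
  show "\<mu> = (\<lambda>A. \<Sum>x\<in>f ` J. (\<Sum>j | j \<in> J \<and> f j = x. c j) * dirac x A)"
  proof
    fix A
    have "(\<Sum>x\<in>f ` J. (\<Sum>j | j \<in> J \<and> f j = x. c j) * dirac x A) =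
        (\<Sum>x\<in>f ` J. \<Sum>j | j \<in> J \<and> f j = x. of_bool (f j \<in> A) * c j)"
      unfolding sum_distrib_right
      by (intro sum.cong refl) (auto simp: dirac_def indicator_def)
    also have "\<dots> = (\<Sum>j\<in>J. of_bool (f j \<in> A) * c j)"
      by (rule sum.image_gen[symmetric]) fact
    finally show "\<mu> A = (\<Sum>x\<in>f ` J. (\<Sum>j | j \<in> J \<and> f j = x. c j) * dirac x A)"
      by (simp add: assms(3))
  qed
qed (use assms in auto)

lemma discrete_measure_sum_points:
  assumes "discrete_measure S \<mu>"
  shows "\<mu> A = (\<Sum>x | x \<in> A \<inter> S \<and> \<mu> {x} \<noteq> 0. \<mu> {x})"
proof -
  obtain T where T: "T \<subseteq> S" "carried_by T \<mu>"
    using assms unfolding discrete_measure_iff_carried_by by blast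
  have "(\<Sum>x | x \<in> A \<inter> S \<and> \<mu> {x} \<noteq> 0. \<mu> {x}) = (\<Sum>x | x \<in> A \<inter> S \<and> \<mu> {x} \<noteq> 0. of_bool (x \<in> A) * \<mu> {x})"
    by (rule sum.cong) auto
  also have "\<dots> = (\<Sum>x\<in>T. of_bool (x \<in> A) * \<mu> {x})"
  proof (rule sum.mono_neutral_left[OF carried_by_finite[OF T(2)]])
    show "{x. x \<in> A \<inter> S \<and> \<mu> {x} \<noteq> 0} \<subseteq> T"
      using carried_by_outside[OF T(2)] by blast
    show "\<forall>x\<in>T - {x. x \<in> A \<inter> S \<and> \<mu> {x} \<noteq> 0}. of_bool (x \<in> A) * \<mu> {x} = 0"
      using T(1) by auto
  qed
  finally show ?thesis
    unfolding carried_byD[OF T(2), of A] by (rule sym)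
qed

lemma discrete_probE:
  assumes "discrete_prob S P"
  obtains T where "T \<subseteq> S" and "carried_by T P" and "(\<Sum>x\<in>T. P {x}) = 1"
proof -
  obtain T where T: "T \<subseteq> S" "carried_by T P"
    using assms unfolding discrete_prob_def discrete_measure_iff_carried_by by blast
  have "P S = (\<Sum>x\<in>T. P {x})"
    unfolding carried_byD[OF T(2), of S] using T(1) by (intro sum.cong) auto
  moreover have "P S = 1"
    using assms unfolding discrete_prob_def by blast
  ultimately show ?thesis
    by (intro that[OF T]) (simp only:)
qed

lemma marginal_eq_sum:
  assumes "carried_by S P" and "S \<subseteq> Pi\<^sub>E I X"
  shows "marginal I X P F A = (\<Sum>y\<in>S. of_bool (restrict y F \<in> A) * P {y})"
  unfolding marginal_def carried_byD[OF assms(1), of "{x \<in> Pi\<^sub>E I X. restrict x F \<in> A}"]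
  using assms(2) by (intro sum.cong) auto

lemma discrete_prob_marginal:
  assumes "discrete_prob (Pi\<^sub>E I X) P" and "F \<subseteq> I"
  shows "discrete_prob (Pi\<^sub>E F X) (marginal I X P F)"
proof -
  obtain T where T: "T \<subseteq> Pi\<^sub>E I X" "carried_by T P"
    using assms(1) by (rule discrete_probE)
  have restr: "restrict y F \<in> Pi\<^sub>E F X" if "y \<in> Pi\<^sub>E I X" for y
    using that assms(2) by auto
  then have "{x \<in> Pi\<^sub>E I X. restrict x F \<in> Pi\<^sub>E F X} = Pi\<^sub>E I X"
    by blast
  moreover have "discrete_measure (Pi\<^sub>E F X) (marginal I X P F)"
    by (rule discrete_measure_weighted_points[OF carried_by_finite[OF T(2)] _ marginal_eq_sum[OF T(2,1)]])
       (use T(1) restr in blast)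
  ultimately show ?thesis
    using assms(1) by (simp add: discrete_prob_def marginal_def)
qed

lemma marginal_marginal:
  assumes "F \<subseteq> H" and "H \<subseteq> I"
  shows "marginal H X (marginal I X P H) F = marginal I X P F"
proof
  fix A
  have "{x \<in> Pi\<^sub>E I X. restrict x H \<in> {v \<in> Pi\<^sub>E H X. restrict v F \<in> A}} =
      {x \<in> Pi\<^sub>E I X. restrict x F \<in> A}"
    using assms by (auto simp: Int_absorb1)
  then show "marginal H X (marginal I X P H) F A = marginal I X P F A"
    by (simp add: marginal_def)
qed

section \<open>Products of two marginals as mixtures of coordinates\<close>

abbreviation hybrid where
  "hybrid I X P Q F \<equiv> times_measure X F (I - F) (marginal I X P F) (marginal I X Q (I - F))"

definition mix :: "'i set \<Rightarrow> 'i set \<Rightarrow> ('i \<Rightarrow> 'a) \<Rightarrow> ('i \<Rightarrow> 'a) \<Rightarrow> 'i \<Rightarrow> 'a" where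
  "mix I F y z = (\<lambda>i\<in>I. if i \<in> F then y i else z i)"

lemma mix_in_PiE:
  assumes "y \<in> Pi\<^sub>E I X" and "z \<in> Pi\<^sub>E I X"
  shows "mix I F y z \<in> Pi\<^sub>E I X"
  using assms by (auto simp: mix_def PiE_iff)

text \<open>
  Extensionality of \<open>x\<close> rules out differences outside \<open>I\<close>.
\<close>

lemma mix_eq_iff:
  assumes "F \<subseteq> I" and "x \<in> extensional I"
  shows "mix I F y z = x \<longleftrightarrow> restrict y F = restrict x F \<and> restrict z (I - F) = restrict x (I - F)"
proof
  assume "restrict y F = restrict x F \<and> restrict z (I - F) = restrict x (I - F)"
  then have "\<And>i. i \<in> F \<Longrightarrow> y i = x i" and "\<And>i. i \<in> I - F \<Longrightarrow> z i = x i"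
    by (metis restrict_apply')+
  then show "mix I F y z = x"
    using assms by (auto simp: mix_def extensional_def)
next
  assume "mix I F y z = x"
  then have "\<And>i. i \<in> F \<Longrightarrow> y i = x i" and "\<And>i. i \<in> I - F \<Longrightarrow> z i = x i"
    using assms(1) by (auto simp: mix_def)
  then show "restrict y F = restrict x F \<and> restrict z (I - F) = restrict x (I - F)"
    by (intro conjI restrict_ext)
qed

text \<open>
  The mass of \<open>P\<^sub>F \<times> Q\<^sub>F'\<close> at \<open>x\<close> is the total weight of all pairs \<open>(y, z)\<close> whose mixture is \<open>x\<close>, so the
  measure is the image of \<open>P \<times> Q\<close> under mixing. This reduces statements about all the measures
  \<open>P\<^sub>F \<times> Q\<^sub>F'\<close> to statements about a single pair of points and the sets \<open>F\<close>.
\<close>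

lemma hybrid_eq_sum:
  assumes "F \<subseteq> I" and S: "carried_by S P" "S \<subseteq> Pi\<^sub>E I X" and T: "carried_by T Q" "T \<subseteq> Pi\<^sub>E I X"
  shows "hybrid I X P Q F A = (\<Sum>y\<in>S. \<Sum>z\<in>T. of_bool (mix I F y z \<in> A) * (P {y} * Q {z}))"
proof -
  let ?g = "\<lambda>x. marginal I X P F {restrict x F} * marginal I X Q (I - F) {restrict x (I - F)}"
  let ?W = "(\<lambda>(y, z). mix I F y z) ` (S \<times> T)"
  have finW: "finite ?W"
    using carried_by_finite S(1) T(1) by blast
  have mixW: "mix I F y z \<in> ?W" if "y \<in> S" "z \<in> T" for y z
    using that by auto
  have W: "?W \<subseteq> Pi\<^sub>E I X"
    using S(2) T(2) by (auto intro!: mix_in_PiE)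
  have g: "?g x = (\<Sum>y\<in>S. \<Sum>z\<in>T. of_bool (mix I F y z = x) * (P {y} * Q {z}))"
    if "x \<in> Pi\<^sub>E I X" for x
    unfolding marginal_eq_sum[OF S] marginal_eq_sum[OF T] sum_product
    using that assms(1) by (intro sum.cong refl) (auto simp: mix_eq_iff PiE_iff)
  have g0: "?g x = 0" if "x \<in> Pi\<^sub>E I X" "x \<notin> ?W" for x
    unfolding g[OF that(1)] using that(2) mixW by (intro sum.neutral ballI) auto
  have I: "F \<union> (I - F) = I"
    using assms(1) by blast
  have "hybrid I X P Q F A = (\<Sum>x | x \<in> A \<inter> Pi\<^sub>E I X \<and> ?g x \<noteq> 0. of_bool (x \<in> A) * ?g x)"
    unfolding times_measure_def I by (rule sum.cong) auto
  also have "\<dots> = (\<Sum>x\<in>?W. of_bool (x \<in> A) * ?g x)"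
    by (rule sum.mono_neutral_left[OF finW]) (use W g0 in \<open>blast, auto\<close>)
  also have "\<dots> = (\<Sum>x\<in>?W. \<Sum>y\<in>S. \<Sum>z\<in>T. of_bool (x \<in> A) * (of_bool (mix I F y z = x) * (P {y} * Q {z})))"
    unfolding sum_distrib_left[symmetric] using W g by (intro sum.cong refl) auto
  also have "\<dots> = (\<Sum>y\<in>S. \<Sum>z\<in>T. \<Sum>x\<in>?W. of_bool (x \<in> A) * (of_bool (mix I F y z = x) * (P {y} * Q {z})))"
    by (subst sum.swap, subst (2) sum.swap) (rule refl)
  also have "\<dots> = (\<Sum>y\<in>S. \<Sum>z\<in>T. of_bool (mix I F y z \<in> A) * (P {y} * Q {z}))"
  proof (intro sum.cong refl)
    fix y z assume yz: "y \<in> S" "z \<in> T"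
    have "(\<Sum>x\<in>?W. of_bool (x \<in> A) * (of_bool (mix I F y z = x) * (P {y} * Q {z}))) =
        (\<Sum>x\<in>?W. if mix I F y z = x then of_bool (mix I F y z \<in> A) * (P {y} * Q {z}) else 0)"
      by (intro sum.cong) auto
    then show "(\<Sum>x\<in>?W. of_bool (x \<in> A) * (of_bool (mix I F y z = x) * (P {y} * Q {z}))) =
        of_bool (mix I F y z \<in> A) * (P {y} * Q {z})"
      using mixW[OF yz] by (simp only: sum.delta'[OF finW] if_True)
  qed
  finally show ?thesis .
qed

lemma hybrid_full:
  assumes "discrete_prob (Pi\<^sub>E I X) P" and "discrete_prob (Pi\<^sub>E I X) Q"
  shows "hybrid I X P Q I = P"
proof
  fix A
  obtain S where S: "S \<subseteq> Pi\<^sub>E I X" "carried_by S P"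
    using assms(1) by (rule discrete_probE)
  obtain T where T: "T \<subseteq> Pi\<^sub>E I X" "carried_by T Q" "(\<Sum>z\<in>T. Q {z}) = 1"
    using assms(2) by (rule discrete_probE)
  have "mix I I y z = y" if "y \<in> S" for y z
    using that S(1) by (auto simp: mix_def PiE_iff extensional_def fun_eq_iff)
  then have "hybrid I X P Q I A = (\<Sum>y\<in>S. \<Sum>z\<in>T. (of_bool (y \<in> A) * P {y}) * Q {z})"
    unfolding hybrid_eq_sum[OF subset_refl S(2,1) T(2,1)] by (intro sum.cong refl) simp
  then show "hybrid I X P Q I A = P A"
    unfolding sum_distrib_left[symmetric] T(3) carried_byD[OF S(2), of A] by simp
qed

text \<open>
  Sorting the subsets by size, the sizes from \<open>k\<close> to \<open>card I - 1\<close> contribute nothing and the full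
  set contributes \<open>P\<close>.
\<close>

lemma Lancaster2_eq_sum_hybrid:
  assumes "finite I" and "k \<le> card I"
    and P: "discrete_prob (Pi\<^sub>E I X) P" and Q: "discrete_prob (Pi\<^sub>E I X) Q"
  shows "Lancaster2 I X k P Q A =
         (\<Sum>F\<in>Pow I. lancaster_coeff (card I) k (card F) * hybrid I X P Q F A)"
proof -
  let ?n = "card I"
  let ?h = "\<lambda>F. lancaster_coeff ?n k (card F) * hybrid I X P Q F A"
  have level: "(\<Sum>F | F \<in> Pow I \<and> card F = j. ?h F) =
      lancaster_coeff ?n k j * (\<Sum>F | F \<subseteq> I \<and> card F = j. hybrid I X P Q F A)" for j
    by (simp add: sum_distrib_left)
  have top: "{F. F \<subseteq> I \<and> card F = ?n} = {I}"
    using assms(1) by (auto dest: card_subset_eq)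
  have levels: "{..?n} = insert ?n ({..<k} \<union> {k..<?n})"
    using assms(2) by auto
  have "(\<Sum>F\<in>Pow I. ?h F) = (\<Sum>j\<in>{..?n}. \<Sum>F | F \<in> Pow I \<and> card F = j. ?h F)"
    by (rule sum.group[symmetric]) (use assms(1) card_mono in auto)
  also have "\<dots> = (\<Sum>j\<in>{..?n}. lancaster_coeff ?n k j * (\<Sum>F | F \<subseteq> I \<and> card F = j. hybrid I X P Q F A))"
    by (simp only: level)
  also have "\<dots> = P A + (\<Sum>j<k. lancaster_coeff ?n k j * (\<Sum>F | F \<subseteq> I \<and> card F = j. hybrid I X P Q F A))"
  proof -
    have "(\<Sum>j\<in>{..<k} \<union> {k..<?n}. lancaster_coeff ?n k j * (\<Sum>F | F \<subseteq> I \<and> card F = j. hybrid I X P Q F A)) =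
        (\<Sum>j<k. lancaster_coeff ?n k j * (\<Sum>F | F \<subseteq> I \<and> card F = j. hybrid I X P Q F A))"
      by (rule sum.mono_neutral_right) (auto simp: lancaster_coeff_between)
    then show ?thesis
      unfolding levels using assms(2)
      by (subst sum.insert) (auto simp: lancaster_coeff_top top hybrid_full[OF P Q, simplified])
  qed
  also have "\<dots> = Lancaster2 I X k P Q A"
    unfolding Lancaster2_def lessThan_atLeast0
    using assms(2) by (intro arg_cong2[where f = "(+)"] sum.cong refl) (simp add: lancaster_coeff_less)
  finally show ?thesis ..
qed

section \<open>Products over a partition\<close>

lemma prod_of_bool:
  assumes "finite S"
  shows "(\<Prod>x\<in>S. of_bool (p x) :: real) = of_bool (\<forall>x\<in>S. p x)"
  using assms by (induction S rule: finite_induct) auto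

lemma partition_on_block_eq:
  assumes "partition_on I \<pi>" and "B \<in> \<pi>" and "i \<in> B"
  shows "(THE B. B \<in> \<pi> \<and> i \<in> B) = B"
proof (rule the_equality)
  fix B' assume "B' \<in> \<pi> \<and> i \<in> B'"
  then show "B' = B"
    using disjointD[OF partition_onD2[OF assms(1)], of B' B] assms(2,3) by blast
qed (use assms in simp)

lemma partition_on_subset: "partition_on I \<pi> \<Longrightarrow> B \<in> \<pi> \<Longrightarrow> B \<subseteq> I"
  by (drule partition_onD1) (simp add: Union_upper)

lemma partition_on_finite_block:
  assumes "finite I" and "partition_on I \<pi>" and "B \<in> \<pi>"
  shows "finite B"
  using finite_subset[OF partition_on_subset[OF assms(2,3)] assms(1)] .

text \<open>
  Distributivity turns the left-hand side into a sum over families of one point in each block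
  box; since the blocks are disjoint and cover \<open>I\<close>, such families correspond to the points of
  the whole box.
\<close>

lemma prod_sum_PiE_partition:
  fixes g :: "'i set \<Rightarrow> ('i \<Rightarrow> 'a) \<Rightarrow> real"
  assumes "finite I" and part: "partition_on I \<pi>" and Y: "\<And>i. finite (Y i)"
  shows "(\<Prod>B\<in>\<pi>. \<Sum>v\<in>Pi\<^sub>E B Y. g B v) = (\<Sum>x\<in>Pi\<^sub>E I Y. \<Prod>B\<in>\<pi>. g B (restrict x B))"
proof -
  define glue :: "('i set \<Rightarrow> 'i \<Rightarrow> 'a) \<Rightarrow> 'i \<Rightarrow> 'a"
    where "glue h = (\<lambda>i\<in>I. h (THE B. B \<in> \<pi> \<and> i \<in> B) i)" for h
  have fin: "finite \<pi>"
    using finite_elements[OF assms(1) part] .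
  have finB: "finite (Pi\<^sub>E B Y)" if "B \<in> \<pi>" for B
    using partition_on_finite_block[OF assms(1) part that] Y by (rule finite_PiE)
  have glue: "glue h i = h B i" if "B \<in> \<pi>" "i \<in> B" for h B i
  proof -
    have "i \<in> I"
      using partition_on_subset[OF part that(1)] that(2) by blast
    then show ?thesis
      by (simp only: glue_def restrict_apply' partition_on_block_eq[OF part that])
  qed
  have block: "\<exists>B\<in>\<pi>. i \<in> B" if "i \<in> I" for i
    using that unfolding partition_onD1[OF part] by blast
  have glue_restrict: "restrict (glue h) B = h B" if "h \<in> (\<Pi>\<^sub>E B\<in>\<pi>. Pi\<^sub>E B Y)" "B \<in> \<pi>" for h B
  proof
    fix i
    have "h B \<in> Pi\<^sub>E B Y"
      using that by (rule PiE_mem)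
    note outside = PiE_arb[OF this]
    show "restrict (glue h) B i = h B i"
      using glue[OF that(2)] outside by (cases "i \<in> B") simp_all
  qed
  have "(\<Prod>B\<in>\<pi>. \<Sum>v\<in>Pi\<^sub>E B Y. g B v) = (\<Sum>h\<in>(\<Pi>\<^sub>E B\<in>\<pi>. Pi\<^sub>E B Y). \<Prod>B\<in>\<pi>. g B (h B))"
    using fin finB by (rule prod_sum_PiE)
  also have "\<dots> = (\<Sum>x\<in>Pi\<^sub>E I Y. \<Prod>B\<in>\<pi>. g B (restrict x B))"
  proof (rule sum.reindex_bij_witness[where i = "\<lambda>x. \<lambda>B\<in>\<pi>. restrict x B" and j = glue])
    fix h assume h: "h \<in> (\<Pi>\<^sub>E B\<in>\<pi>. Pi\<^sub>E B Y)"
    show "(\<lambda>B\<in>\<pi>. restrict (glue h) B) = h"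
    proof
      fix B
      show "(\<lambda>B\<in>\<pi>. restrict (glue h) B) B = h B"
        using glue_restrict[OF h] PiE_arb[OF h] by (cases "B \<in> \<pi>") simp_all
    qed
    show "glue h \<in> Pi\<^sub>E I Y"
    proof (rule PiE_I)
      fix i assume "i \<in> I"
      then obtain B where B: "B \<in> \<pi>" "i \<in> B"
        using block by blast
      then show "glue h i \<in> Y i"
        unfolding glue[OF B] using PiE_mem[OF PiE_mem[OF h B(1)] B(2)] by simp
    qed (simp add: glue_def)
    show "(\<Prod>B\<in>\<pi>. g B (restrict (glue h) B)) = (\<Prod>B\<in>\<pi>. g B (h B))"
      using glue_restrict[OF h] by (intro prod.cong) simp_all
  next
    fix x assume x: "x \<in> Pi\<^sub>E I Y"
    show "glue (\<lambda>B\<in>\<pi>. restrict x B) = x"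
    proof
      fix i
      show "glue (\<lambda>B\<in>\<pi>. restrict x B) i = x i"
      proof (cases "i \<in> I")
        case True
        then obtain B where B: "B \<in> \<pi>" "i \<in> B"
          using block by blast
        then show ?thesis
          unfolding glue[OF B] by simp
      qed (use PiE_arb[OF x] in \<open>simp add: glue_def\<close>)
    qed
    show "(\<lambda>B\<in>\<pi>. restrict x B) \<in> (\<Pi>\<^sub>E B\<in>\<pi>. Pi\<^sub>E B Y)"
      using x partition_on_subset[OF part] by (intro restrict_PiE_iff[THEN iffD2] ballI PiE_mem[OF x]) blast
  qed
  finally show ?thesis .
qed

text \<open>
  The analogue of the previous lemma for subsets: a subset of \<open>I\<close> amounts to a choice of one subset
  of each block.
\<close>

lemma prod_sum_Pow_partition:
  fixes g :: "'i set \<Rightarrow> 'i set \<Rightarrow> real"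
  assumes "finite I" and part: "partition_on I \<pi>"
  shows "(\<Prod>B\<in>\<pi>. \<Sum>H\<in>Pow B. g B H) = (\<Sum>F\<in>Pow I. \<Prod>B\<in>\<pi>. g B (F \<inter> B))"
proof -
  have fin: "finite \<pi>"
    using finite_elements[OF assms(1) part] .
  have finB: "finite (Pow B)" if "B \<in> \<pi>" for B
    using partition_on_finite_block[OF assms(1) part that] by simp
  have union_Int: "(\<Union>B\<in>\<pi>. h B) \<inter> B = h B" if h: "h \<in> Pi\<^sub>E \<pi> Pow" and B: "B \<in> \<pi>" for h B
  proof
    show "(\<Union>B\<in>\<pi>. h B) \<inter> B \<subseteq> h B"
    proof
      fix i assume "i \<in> (\<Union>B\<in>\<pi>. h B) \<inter> B"
      then obtain B' where B': "B' \<in> \<pi>" "i \<in> h B'" "i \<in> B"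
        by blast
      then have "i \<in> B'"
        using PiE_mem[OF h B'(1)] by blast
      then have "B' = B"
        using disjointD[OF partition_onD2[OF part], of B' B] B B' by blast
      then show "i \<in> h B"
        using B' by simp
    qed
    show "h B \<subseteq> (\<Union>B\<in>\<pi>. h B) \<inter> B"
      using PiE_mem[OF h B] B by blast
  qed
  have "(\<Prod>B\<in>\<pi>. \<Sum>H\<in>Pow B. g B H) = (\<Sum>h\<in>Pi\<^sub>E \<pi> Pow. \<Prod>B\<in>\<pi>. g B (h B))"
    using fin finB by (rule prod_sum_PiE)
  also have "\<dots> = (\<Sum>F\<in>Pow I. \<Prod>B\<in>\<pi>. g B (F \<inter> B))"
  proof (rule sum.reindex_bij_witness[where i = "\<lambda>F. \<lambda>B\<in>\<pi>. F \<inter> B" and j = "\<lambda>h. \<Union>B\<in>\<pi>. h B"])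
    fix h assume h: "h \<in> Pi\<^sub>E \<pi> Pow"
    show "(\<lambda>B\<in>\<pi>. (\<Union>B\<in>\<pi>. h B) \<inter> B) = h"
    proof
      fix B
      show "(\<lambda>B\<in>\<pi>. (\<Union>B\<in>\<pi>. h B) \<inter> B) B = h B"
        using union_Int[OF h, of B] PiE_arb[OF h, of B] by (cases "B \<in> \<pi>") simp_all
    qed
    show "(\<Union>B\<in>\<pi>. h B) \<in> Pow I"
      using PiE_mem[OF h] partition_on_subset[OF part] by blast
    show "(\<Prod>B\<in>\<pi>. g B ((\<Union>B\<in>\<pi>. h B) \<inter> B)) = (\<Prod>B\<in>\<pi>. g B (h B))"
      using union_Int[OF h] by (intro prod.cong) simp_all
  next
    fix F assume "F \<in> Pow I"
    then show "(\<Union>B\<in>\<pi>. (\<lambda>B\<in>\<pi>. F \<inter> B) B) = F"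
      using partition_onD1[OF part] by auto
    show "(\<lambda>B\<in>\<pi>. F \<inter> B) \<in> Pi\<^sub>E \<pi> Pow"
      by auto
  qed
  finally show ?thesis .
qed

text \<open>
  All sums over points can then be taken over finite boxes, which distributivity requires.
  \<open>Y i\<close> collects the \<open>i\<close>-th coordinates of the carriers.
\<close>

lemma discrete_measures_common_box:
  assumes "finite I" and part: "partition_on I \<pi>"
    and m: "\<And>B. B \<in> \<pi> \<Longrightarrow> discrete_measure (Pi\<^sub>E B X) (m B)"
  obtains Y where "\<And>i. finite (Y i)" and "\<And>i. i \<in> I \<Longrightarrow> Y i \<subseteq> X i"
    and "\<And>B. B \<in> \<pi> \<Longrightarrow> carried_by (Pi\<^sub>E B Y) (m B)"
proof -
  have fin: "finite \<pi>"
    using finite_elements[OF assms(1) part] .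
  have "\<forall>B\<in>\<pi>. \<exists>T. T \<subseteq> Pi\<^sub>E B X \<and> carried_by T (m B)"
    using m unfolding discrete_measure_iff_carried_by by blast
  then obtain T where T: "\<And>B. B \<in> \<pi> \<Longrightarrow> T B \<subseteq> Pi\<^sub>E B X" "\<And>B. B \<in> \<pi> \<Longrightarrow> carried_by (T B) (m B)"
    by metis
  define Y where "Y = (\<lambda>i. \<Union>B\<in>{B \<in> \<pi>. i \<in> B}. (\<lambda>v. v i) ` T B)"
  have Yfin: "finite (Y i)" for i
    unfolding Y_def using fin carried_by_finite[OF T(2)] by auto
  have "Y i \<subseteq> X i" for i
    unfolding Y_def using T(1) by (fastforce dest: PiE_mem)
  moreover have "carried_by (Pi\<^sub>E B Y) (m B)" if B: "B \<in> \<pi>" for B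
  proof (rule carried_by_mono[OF T(2)[OF B]])
    show "T B \<subseteq> Pi\<^sub>E B Y"
    proof
      fix v assume v: "v \<in> T B"
      then have "v \<in> Pi\<^sub>E B X"
        using T(1)[OF B] by blast
      then show "v \<in> Pi\<^sub>E B Y"
        using v B by (auto simp: PiE_iff Y_def)
    qed
    show "finite (Pi\<^sub>E B Y)"
      using partition_on_finite_block[OF assms(1) part B] Yfin by (rule finite_PiE)
  qed
  ultimately show ?thesis
    using Yfin that by blast
qed

lemma Times_measure_eq_sum_box:
  assumes "finite I" and part: "partition_on I \<pi>"
    and Y: "\<And>i. finite (Y i)" "\<And>i. i \<in> I \<Longrightarrow> Y i \<subseteq> X i"
    and m: "\<And>B. B \<in> \<pi> \<Longrightarrow> carried_by (Pi\<^sub>E B Y) (m B)"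
  shows "Times_measure X \<pi> m A =
         (\<Sum>x\<in>Pi\<^sub>E I Y. of_bool (x \<in> A) * (\<Prod>B\<in>\<pi>. m B {restrict x B}))"
proof -
  have U: "\<Union>\<pi> = I"
    using partition_onD1[OF part] by simp
  have fin: "finite \<pi>"
    using finite_elements[OF assms(1) part] .
  let ?g = "\<lambda>x. \<Prod>B\<in>\<pi>. m B {restrict x B}"
  have box: "x \<in> Pi\<^sub>E I Y" if x: "x \<in> Pi\<^sub>E I X" "?g x \<noteq> 0" for x
  proof (rule PiE_I)
    fix i assume "i \<in> I"
    then obtain B where B: "B \<in> \<pi>" "i \<in> B"
      using U by blast
    then have "m B {restrict x B} \<noteq> 0"
      using x(2) fin by (simp add: prod_zero_iff)
    then have "restrict x B \<in> Pi\<^sub>E B Y"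
      using carried_by_outside[OF m[OF B(1)]] by blast
    then have "restrict x B i \<in> Y i"
      using B(2) by (rule PiE_mem)
    then show "x i \<in> Y i"
      using B(2) by simp
  qed (use PiE_arb[OF x(1)] in simp)
  have sub: "Pi\<^sub>E I Y \<subseteq> Pi\<^sub>E I X"
    using Y(2) by (rule PiE_mono)
  have "Times_measure X \<pi> m A = (\<Sum>x | x \<in> A \<inter> Pi\<^sub>E I X \<and> ?g x \<noteq> 0. of_bool (x \<in> A) * ?g x)"
    unfolding Times_measure_def U by (rule sum.cong) auto
  also have "\<dots> = (\<Sum>x\<in>Pi\<^sub>E I Y. of_bool (x \<in> A) * ?g x)"
  proof (rule sum.mono_neutral_left)
    show "finite (Pi\<^sub>E I Y)"
      using assms(1) Y(1) by (intro finite_PiE)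
    show "{x. x \<in> A \<inter> Pi\<^sub>E I X \<and> ?g x \<noteq> 0} \<subseteq> Pi\<^sub>E I Y"
      using box by blast
    show "\<forall>x\<in>Pi\<^sub>E I Y - {x. x \<in> A \<inter> Pi\<^sub>E I X \<and> ?g x \<noteq> 0}. of_bool (x \<in> A) * ?g x = 0"
      using sub by auto
  qed
  finally show ?thesis .
qed

lemma Times_measure_rectangle:
  assumes "finite I" and part: "partition_on I \<pi>"
    and m: "\<And>B. B \<in> \<pi> \<Longrightarrow> discrete_measure (Pi\<^sub>E B X) (m B)"
  shows "Times_measure X \<pi> m {x \<in> Pi\<^sub>E I X. \<forall>B\<in>\<pi>. restrict x B \<in> C B} = (\<Prod>B\<in>\<pi>. m B (C B))"
proof -
  obtain Y where Y: "\<And>i. finite (Y i)" "\<And>i. i \<in> I \<Longrightarrow> Y i \<subseteq> X i"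
      and mY: "\<And>B. B \<in> \<pi> \<Longrightarrow> carried_by (Pi\<^sub>E B Y) (m B)"
    using discrete_measures_common_box[where X = X and m = m, OF assms(1) part m] by blast
  have fin: "finite \<pi>"
    using finite_elements[OF assms(1) part] .
  have sub: "Pi\<^sub>E I Y \<subseteq> Pi\<^sub>E I X"
    using Y(2) by (rule PiE_mono)
  have "(\<Prod>B\<in>\<pi>. m B (C B)) = (\<Prod>B\<in>\<pi>. \<Sum>v\<in>Pi\<^sub>E B Y. of_bool (v \<in> C B) * m B {v})"
    by (intro prod.cong refl carried_byD mY)
  also have "\<dots> = (\<Sum>x\<in>Pi\<^sub>E I Y. \<Prod>B\<in>\<pi>. of_bool (restrict x B \<in> C B) * m B {restrict x B})"
    by (rule prod_sum_PiE_partition[OF assms(1) part Y(1)])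
  also have "\<dots> = (\<Sum>x\<in>Pi\<^sub>E I Y. of_bool (x \<in> {x \<in> Pi\<^sub>E I X. \<forall>B\<in>\<pi>. restrict x B \<in> C B}) *
      (\<Prod>B\<in>\<pi>. m B {restrict x B}))"
    unfolding prod.distrib prod_of_bool[OF fin] using sub by (intro sum.cong refl) auto
  also have "\<dots> = Times_measure X \<pi> m {x \<in> Pi\<^sub>E I X. \<forall>B\<in>\<pi>. restrict x B \<in> C B}"
    by (rule Times_measure_eq_sum_box[OF assms(1) part Y mY, symmetric])
  finally show ?thesis ..
qed

text \<open>
  Fixing the coordinates in \<open>F\<close> amounts to fixing, independently in each block \<open>B\<close>, those in
  \<open>F \<inter> B\<close>. Such an event is a rectangle with respect to the partition.
\<close>

lemma marginal_partition_product:
  assumes "finite I" and part: "partition_on I \<pi>" and P: "discrete_prob (Pi\<^sub>E I X) P" and "F \<subseteq> I"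
  shows "marginal I X (partition_product I X P \<pi>) F {restrict x F} =
         (\<Prod>B\<in>\<pi>. marginal I X P (F \<inter> B) {restrict x (F \<inter> B)})"
proof -
  let ?C = "\<lambda>B. {v. restrict v (F \<inter> B) = restrict x (F \<inter> B)}"
  have m: "discrete_measure (Pi\<^sub>E B X) (marginal I X P B)" if "B \<in> \<pi>" for B
    using discrete_prob_marginal[OF P partition_on_subset[OF part that]]
    by (simp add: discrete_prob_def)
  have "restrict y F = restrict x F \<longleftrightarrow> (\<forall>B\<in>\<pi>. restrict y (F \<inter> B) = restrict x (F \<inter> B))" for y
  proof
    assume "\<forall>B\<in>\<pi>. restrict y (F \<inter> B) = restrict x (F \<inter> B)"
    then have "y i = x i" if "i \<in> F" "i \<in> B" "B \<in> \<pi>" for i B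
      using that by (metis IntI restrict_apply')
    then show "restrict y F = restrict x F"
      using assms(4) partition_onD1[OF part] by (intro restrict_ext) blast
  qed (metis restrict_restrict)
  then have "{y \<in> Pi\<^sub>E I X. restrict y F \<in> {restrict x F}} =
      {y \<in> Pi\<^sub>E I X. \<forall>B\<in>\<pi>. restrict y B \<in> ?C B}"
    by (simp add: Int_commute)
  then have "marginal I X (partition_product I X P \<pi>) F {restrict x F} =
      (\<Prod>B\<in>\<pi>. marginal I X P B (?C B))"
    unfolding partition_product_def marginal_def[of I X "Times_measure X \<pi> (marginal I X P)"]
    by (simp only: Times_measure_rectangle[OF assms(1) part m])
  also have "\<dots> = (\<Prod>B\<in>\<pi>. marginal I X P (F \<inter> B) {restrict x (F \<inter> B)})"
    by (simp add: marginal_def Int_absorb1 Int_commute Int_left_commute)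
  finally show ?thesis .
qed

lemma discrete_prob_partition_product:
  assumes "finite I" and part: "partition_on I \<pi>" and P: "discrete_prob (Pi\<^sub>E I X) P"
  shows "discrete_prob (Pi\<^sub>E I X) (partition_product I X P \<pi>)"
proof -
  have mP: "discrete_prob (Pi\<^sub>E B X) (marginal I X P B)" if "B \<in> \<pi>" for B
    using discrete_prob_marginal[OF P partition_on_subset[OF part that]] .
  then have m: "discrete_measure (Pi\<^sub>E B X) (marginal I X P B)" if "B \<in> \<pi>" for B
    using that by (simp add: discrete_prob_def)
  obtain Y where Y: "\<And>i. finite (Y i)" "\<And>i. i \<in> I \<Longrightarrow> Y i \<subseteq> X i"
      and mY: "\<And>B. B \<in> \<pi> \<Longrightarrow> carried_by (Pi\<^sub>E B Y) (marginal I X P B)"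
    using discrete_measures_common_box[where X = X and m = "marginal I X P", OF assms(1) part m] by blast
  have "discrete_measure (Pi\<^sub>E I X) (partition_product I X P \<pi>)"
    unfolding partition_product_def
    using finite_PiE[OF assms(1) Y(1)] subsetD[OF PiE_mono[of I Y X, OF Y(2)]]
      Times_measure_eq_sum_box[OF assms(1) part Y mY]
    by (rule discrete_measure_weighted_points)
  moreover have "0 \<le> partition_product I X P \<pi> A" for A
    unfolding partition_product_def Times_measure_def
    using mP by (intro sum_nonneg prod_nonneg) (simp add: discrete_prob_def)
  moreover have "partition_product I X P \<pi> (Pi\<^sub>E I X) = 1"
  proof -
    have "{x \<in> Pi\<^sub>E I X. \<forall>B\<in>\<pi>. restrict x B \<in> Pi\<^sub>E B X} = Pi\<^sub>E I X"
      using partition_on_subset[OF part] by (auto simp: PiE_iff extensional_def)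
    then show ?thesis
      using Times_measure_rectangle[OF assms(1) part m, where C = "\<lambda>B. Pi\<^sub>E B X"] mP
      by (simp add: partition_product_def discrete_prob_def)
  qed
  ultimately show ?thesis
    by (simp add: discrete_prob_def)
qed

section \<open>Interactions annihilate rectangles with few proper sides\<close>

lemma discrete_measure_Lancaster2:
  assumes "finite I" and "k \<le> card I"
    and P: "discrete_prob (Pi\<^sub>E I X) P" and Q: "discrete_prob (Pi\<^sub>E I X) Q"
  shows "discrete_measure (Pi\<^sub>E I X) (Lancaster2 I X k P Q)"
proof -
  obtain S where S: "S \<subseteq> Pi\<^sub>E I X" "carried_by S P"
    using P by (rule discrete_probE)
  obtain T where T: "T \<subseteq> Pi\<^sub>E I X" "carried_by T Q"
    using Q by (rule discrete_probE)
  show ?thesis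
  proof (rule discrete_measure_weighted_points)
    show "finite (Pow I \<times> S \<times> T)"
      using assms(1) carried_by_finite[OF S(2)] carried_by_finite[OF T(2)] by simp
    show "(case j of (F, y, z) \<Rightarrow> mix I F y z) \<in> Pi\<^sub>E I X" if "j \<in> Pow I \<times> S \<times> T" for j
    proof (cases j)
      case (fields F y z)
      then have "y \<in> Pi\<^sub>E I X" "z \<in> Pi\<^sub>E I X"
        using that S(1) T(1) by auto
      then show ?thesis
        unfolding fields by (simp add: mix_in_PiE)
    qed
    fix A
    have "Lancaster2 I X k P Q A = (\<Sum>F\<in>Pow I. \<Sum>y\<in>S. \<Sum>z\<in>T.
        of_bool (mix I F y z \<in> A) * (lancaster_coeff (card I) k (card F) * P {y} * Q {z}))"
      unfolding Lancaster2_eq_sum_hybrid[OF assms]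
      by (intro sum.cong refl)
         (simp add: hybrid_eq_sum[OF _ S(2,1) T(2,1)] sum_distrib_left algebra_simps)
    then show "Lancaster2 I X k P Q A = (\<Sum>j\<in>Pow I \<times> S \<times> T.
        of_bool ((case j of (F, y, z) \<Rightarrow> mix I F y z) \<in> A) *
        (case j of (F, y, z) \<Rightarrow> lancaster_coeff (card I) k (card F) * P {y} * Q {z}))"
      by (simp add: sum.cartesian_product case_prod_unfold)
  qed
qed

text \<open>
  In a coordinate where the rectangle is the full factor, both candidates satisfy the constraint, so it
  does not matter from which point this coordinate is taken.
\<close>

lemma mix_in_rectangle_iff:
  assumes y: "y \<in> Pi\<^sub>E I X" and z: "z \<in> Pi\<^sub>E I X"
  shows "mix I F y z \<in> Pi\<^sub>E I A \<longleftrightarrow> mix I (F \<inter> {i \<in> I. A i \<noteq> X i}) y z \<in> Pi\<^sub>E I A"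
proof -
  have "mix I F y z i \<in> A i \<longleftrightarrow> mix I (F \<inter> {i \<in> I. A i \<noteq> X i}) y z i \<in> A i" if "i \<in> I" for i
    using that PiE_mem[OF y that] PiE_mem[OF z that] by (cases "A i = X i") (auto simp: mix_def)
  then show ?thesis
    by (simp add: PiE_iff mix_def)
qed

text \<open>
  The rectangle is proper in fewer than \<open>k\<close> coordinates. By \<open>mix_in_rectangle_iff\<close> membership of a
  mixture depends only on the trace of \<open>F\<close> on them, and \<open>lancaster_coeff_sum_trace\<close> makes the sum
  over \<open>F\<close> vanish for each pair of points.
\<close>

lemma Lancaster2_in_M_space:
  assumes "finite I" and "k \<le> card I"
    and P: "discrete_prob (Pi\<^sub>E I X) P" and Q: "discrete_prob (Pi\<^sub>E I X) Q"
  shows "Lancaster2 I X k P Q \<in> M_space I X k"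
  unfolding M_space_def
proof (intro CollectI conjI allI impI)
  show "discrete_measure (Pi\<^sub>E I X) (Lancaster2 I X k P Q)"
    by (rule discrete_measure_Lancaster2[OF assms])
next
  fix A
  assume A: "(\<forall>i\<in>I. A i \<subseteq> X i) \<and> card I - k + 1 \<le> card {i \<in> I. A i = X i}"
  let ?C = "{i \<in> I. A i \<noteq> X i}"
  let ?c = "\<lambda>F. lancaster_coeff (card I) k (card F)"
  obtain S where S: "S \<subseteq> Pi\<^sub>E I X" "carried_by S P"
    using P by (rule discrete_probE)
  obtain T where T: "T \<subseteq> Pi\<^sub>E I X" "carried_by T Q"
    using Q by (rule discrete_probE)
  have "card I = card ({i \<in> I. A i = X i} \<union> ?C)"
    by (intro arg_cong[where f = card]) blast
  also have "\<dots> = card {i \<in> I. A i = X i} + card ?C"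
    using assms(1) by (intro card_Un_disjoint) auto
  finally have C: "card ?C < k"
    using conjunct2[OF A] assms(2) by linarith
  have zero: "(\<Sum>F\<in>Pow I. ?c F * of_bool (mix I F y z \<in> Pi\<^sub>E I A)) = 0" if yz: "y \<in> S" "z \<in> T" for y z
  proof -
    have "y \<in> Pi\<^sub>E I X" "z \<in> Pi\<^sub>E I X"
      using yz S(1) T(1) by blast+
    then have "(\<Sum>F\<in>Pow I. ?c F * of_bool (mix I F y z \<in> Pi\<^sub>E I A)) =
        (\<Sum>F\<in>Pow I. ?c F * of_bool (mix I (F \<inter> ?C) y z \<in> Pi\<^sub>E I A))"
      by (intro sum.cong refl arg_cong2[where f = "(*)"] arg_cong[where f = of_bool] mix_in_rectangle_iff)
    also have "\<dots> = 0"
      using lancaster_coeff_sum_trace[of I ?C k "\<lambda>H. of_bool (mix I H y z \<in> Pi\<^sub>E I A)"] assms(1,2) C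
      by simp
    finally show ?thesis .
  qed
  have "Lancaster2 I X k P Q (Pi\<^sub>E I A) = (\<Sum>F\<in>Pow I. \<Sum>y\<in>S. \<Sum>z\<in>T.
      ?c F * of_bool (mix I F y z \<in> Pi\<^sub>E I A) * (P {y} * Q {z}))"
    unfolding Lancaster2_eq_sum_hybrid[OF assms]
    by (intro sum.cong refl)
       (simp add: hybrid_eq_sum[OF _ S(2,1) T(2,1)] sum_distrib_left mult.assoc)
  also have "\<dots> = (\<Sum>y\<in>S. \<Sum>z\<in>T. (\<Sum>F\<in>Pow I. ?c F * of_bool (mix I F y z \<in> Pi\<^sub>E I A)) * (P {y} * Q {z}))"
    unfolding sum_distrib_right
    by (subst sum.swap, subst (2) sum.swap) (rule refl)
  also have "\<dots> = 0"
    using zero by (intro sum.neutral ballI) simp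
  finally show "Lancaster2 I X k P Q (Pi\<^sub>E I A) = 0" .
qed

section \<open>Independent resampling of coordinates\<close>

definition product_of_marginals ::
  "'i set \<Rightarrow> ('i \<Rightarrow> 'a set) \<Rightarrow> (('i \<Rightarrow> 'a) set \<Rightarrow> real) \<Rightarrow> ('i \<Rightarrow> 'a) set \<Rightarrow> real" where
  "product_of_marginals I X P = partition_product I X P ((\<lambda>i. {i}) ` I)"

abbreviation coord_mass where
  "coord_mass I X P x i \<equiv> marginal I X P {i} {restrict x {i}}"

lemma partition_on_singletons: "partition_on I ((\<lambda>i. {i}) ` I)"
  by (rule partition_onI) (auto simp: disjnt_def)

lemma discrete_prob_product_of_marginals:
  assumes "finite I" and "discrete_prob (Pi\<^sub>E I X) P"
  shows "discrete_prob (Pi\<^sub>E I X) (product_of_marginals I X P)"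
  unfolding product_of_marginals_def
  by (rule discrete_prob_partition_product[OF assms(1) partition_on_singletons assms(2)])

lemma marginal_product_of_marginals:
  assumes "finite I" and P: "discrete_prob (Pi\<^sub>E I X) P" and "F \<subseteq> I"
  shows "marginal I X (product_of_marginals I X P) F {restrict x F} = (\<Prod>i\<in>F. coord_mass I X P x i)"
proof -
  have empty: "marginal I X P {} {restrict x {}} = 1"
    using P by (simp add: marginal_def discrete_prob_def restrict_def)
  have "marginal I X (product_of_marginals I X P) F {restrict x F} =
      (\<Prod>i\<in>I. marginal I X P (F \<inter> {i}) {restrict x (F \<inter> {i})})"
    unfolding product_of_marginals_def
      marginal_partition_product[OF assms(1) partition_on_singletons P assms(3)]
    by (subst prod.reindex) auto
  also have "\<dots> = (\<Prod>i\<in>F. marginal I X P (F \<inter> {i}) {restrict x (F \<inter> {i})})"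
    using assms(1,3) empty by (intro prod.mono_neutral_right) auto
  also have "\<dots> = (\<Prod>i\<in>F. coord_mass I X P x i)"
    by (intro prod.cong refl) simp
  finally show ?thesis .
qed

text \<open>
  Replacing some coordinates of a sample of a product measure by those of an independent sample does
  not change its distribution.
\<close>

lemma hybrid_product_of_marginals:
  assumes "finite I" and P: "discrete_prob (Pi\<^sub>E I X) P" and "F \<subseteq> I"
  shows "hybrid I X (product_of_marginals I X P) (product_of_marginals I X P) F =
         product_of_marginals I X P"
proof
  fix A
  let ?Q = "product_of_marginals I X P"
  have I: "F \<union> (I - F) = I"
    using assms(3) by blast
  have mass: "marginal I X ?Q F {restrict x F} * marginal I X ?Q (I - F) {restrict x (I - F)} =
      (\<Prod>i\<in>I. coord_mass I X P x i)" for x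
    unfolding marginal_product_of_marginals[OF assms] marginal_product_of_marginals[OF assms(1,2) Diff_subset]
    using prod.subset_diff[OF assms(3,1), of "coord_mass I X P x"] by (simp only: mult.commute)
  have blocks: "(\<Prod>B\<in>(\<lambda>i. {i}) ` I. marginal I X P B {restrict x B}) = (\<Prod>i\<in>I. coord_mass I X P x i)" for x
    by (subst prod.reindex) auto
  have U: "\<Union>((\<lambda>i. {i}) ` I) = I"
    by blast
  show "hybrid I X ?Q ?Q F A = ?Q A"
    unfolding times_measure_def mass I
    unfolding product_of_marginals_def partition_product_def Times_measure_def blocks U ..
qed

lemma mix_mix:
  "mix I G (mix I F y w) z = mix I (F \<inter> G) y (mix I G w z)"
  by (auto simp: mix_def fun_eq_iff)

text \<open>
  The coordinates outside \<open>G\<close> are redrawn from the product measure \<open>Q\<close>. Those in \<open>F \<inter> G\<close> still come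
  from \<open>P\<close>; all the others come from \<open>Q\<close>, possibly from two different copies of it, but by
  \<open>hybrid_product_of_marginals\<close> two independent copies mix to one.
\<close>

lemma resample_hybrid:
  assumes "finite I" and P: "discrete_prob (Pi\<^sub>E I X) P" and F: "F \<subseteq> I" and G: "G \<subseteq> I"
    and T: "carried_by T (product_of_marginals I X P)" "T \<subseteq> Pi\<^sub>E I X"
  shows "(\<Sum>z\<in>T. product_of_marginals I X P {z} *
            hybrid I X P (product_of_marginals I X P) F {y. mix I G y z \<in> A}) =
         hybrid I X P (product_of_marginals I X P) (F \<inter> G) A"
proof -
  let ?Q = "product_of_marginals I X P"
  obtain S where S: "S \<subseteq> Pi\<^sub>E I X" "carried_by S P"
    using P by (rule discrete_probE)
  have FG: "F \<inter> G \<subseteq> I"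
    using F by blast
  have Q: "(\<Sum>w\<in>T. \<Sum>z\<in>T. of_bool (mix I G w z \<in> B) * (?Q {w} * ?Q {z})) = ?Q B" for B
    using hybrid_eq_sum[OF G T T, of B] hybrid_product_of_marginals[OF assms(1) P G] by simp
  have "(\<Sum>z\<in>T. ?Q {z} * hybrid I X P ?Q F {y. mix I G y z \<in> A}) =
      (\<Sum>z\<in>T. \<Sum>y\<in>S. \<Sum>w\<in>T. P {y} * (of_bool (mix I (F \<inter> G) y (mix I G w z) \<in> A) * (?Q {w} * ?Q {z})))"
    unfolding hybrid_eq_sum[OF F S(2,1) T] sum_distrib_left
    by (intro sum.cong refl) (simp add: mix_mix)
  also have "\<dots> = (\<Sum>y\<in>S. \<Sum>w\<in>T. \<Sum>z\<in>T. P {y} * (of_bool (mix I (F \<inter> G) y (mix I G w z) \<in> A) * (?Q {w} * ?Q {z})))"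
    by (subst sum.swap, subst (2) sum.swap) (rule refl)
  also have "\<dots> = (\<Sum>y\<in>S. P {y} * ?Q {v. mix I (F \<inter> G) y v \<in> A})"
    using Q[of "{v. mix I (F \<inter> G) y v \<in> A}" for y]
    by (simp only: sum_distrib_left[symmetric] mem_Collect_eq)
  also have "\<dots> = (\<Sum>y\<in>S. \<Sum>w\<in>T. of_bool (mix I (F \<inter> G) y w \<in> A) * (P {y} * ?Q {w}))"
    by (intro sum.cong refl, subst carried_byD[OF T(1)]) (simp add: sum_distrib_left mult.left_commute)
  also have "\<dots> = hybrid I X P ?Q (F \<inter> G) A"
    unfolding hybrid_eq_sum[OF FG S(2,1) T] ..
  finally show ?thesis .
qed

lemma Lancaster_eq_sum_hybrid:
  assumes "finite I" and "k \<le> card I" and "discrete_prob (Pi\<^sub>E I X) P"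
  shows "Lancaster I X k P A =
         (\<Sum>F\<in>Pow I. lancaster_coeff (card I) k (card F) * hybrid I X P (product_of_marginals I X P) F A)"
  unfolding Lancaster_def product_of_marginals_def[symmetric]
  by (rule Lancaster2_eq_sum_hybrid[OF assms discrete_prob_product_of_marginals[OF assms(1,3)]])

text \<open>
  Redrawing the coordinates outside \<open>G\<close> is linear and therefore annihilates \<open>\<Lambda>\<^sub>k = 0\<close>; on the other
  hand it replaces \<open>F\<close> by \<open>F \<inter> G\<close> in each summand, and \<open>lancaster_coeff_sum_trace\<close> evaluates the
  coefficients. The sum obtained is the top interaction of \<open>P\<^sub>G\<close> times the marginal of \<open>Q\<close> on the
  complement of \<open>G\<close>.
\<close>

lemma Lancaster_zero_imp_face_sum_zero:
  assumes "finite I" and P: "discrete_prob (Pi\<^sub>E I X) P" and G: "G \<subseteq> I" "card G = k"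
    and zero: "Lancaster I X k P = (\<lambda>_. 0)"
  shows "(\<Sum>F\<in>Pow G. (-1) ^ (k + card F) * hybrid I X P (product_of_marginals I X P) F A) = 0"
proof -
  let ?Q = "product_of_marginals I X P"
  let ?c = "\<lambda>F. lancaster_coeff (card I) k (card F)"
  obtain T where T: "T \<subseteq> Pi\<^sub>E I X" "carried_by T ?Q"
    using discrete_prob_product_of_marginals[OF assms(1) P] by (rule discrete_probE)
  have k: "k \<le> card I"
    using card_mono[OF assms(1) G(1)] G(2) by simp
  have "(\<Sum>F\<in>Pow G. (-1) ^ (k + card F) * hybrid I X P ?Q F A) =
      (\<Sum>F\<in>Pow I. ?c F * hybrid I X P ?Q (F \<inter> G) A)"
    using lancaster_coeff_sum_trace[OF assms(1) G(1) _ k, of "\<lambda>F. hybrid I X P ?Q F A"] G(2) by simp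
  also have "\<dots> = (\<Sum>F\<in>Pow I. \<Sum>z\<in>T. ?Q {z} * (?c F * hybrid I X P ?Q F {y. mix I G y z \<in> A}))"
    by (intro sum.cong refl)
       (simp add: resample_hybrid[OF assms(1) P _ G(1) T(2,1), symmetric] sum_distrib_left mult.left_commute)
  also have "\<dots> = (\<Sum>z\<in>T. ?Q {z} * Lancaster I X k P {y. mix I G y z \<in> A})"
    unfolding Lancaster_eq_sum_hybrid[OF assms(1) k P] sum_distrib_left by (rule sum.swap)
  also have "\<dots> = 0"
    by (simp add: zero)
  finally show ?thesis .
qed

text \<open>
  In the double sum each \<open>F\<close> occurs once for every \<open>G\<close> of size \<open>k\<close> that contains it, which is
  exactly the correction in \<open>lancaster_coeff_Suc\<close>.
\<close>

lemma Lancaster_Suc: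
  assumes "finite I" and "k < card I" and P: "discrete_prob (Pi\<^sub>E I X) P"
  shows "Lancaster I X (Suc k) P A = Lancaster I X k P A -
         (\<Sum>G | G \<subseteq> I \<and> card G = k. \<Sum>F\<in>Pow G.
            (-1) ^ (k + card F) * hybrid I X P (product_of_marginals I X P) F A)"
proof -
  let ?n = "card I"
  let ?h = "\<lambda>F. hybrid I X P (product_of_marginals I X P) F A"
  have fin: "finite {G. G \<subseteq> I \<and> card G = k}"
    using assms(1) by simp
  have "(\<Sum>G | G \<subseteq> I \<and> card G = k. \<Sum>F\<in>Pow G. (-1) ^ (k + card F) * ?h F) =
      (\<Sum>G | G \<subseteq> I \<and> card G = k. \<Sum>F | F \<in> Pow I \<and> F \<subseteq> G. (-1) ^ (k + card F) * ?h F)"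
    by (intro sum.cong refl) auto
  also have "\<dots> = (\<Sum>F\<in>Pow I. \<Sum>G | G \<in> {G. G \<subseteq> I \<and> card G = k} \<and> F \<subseteq> G. (-1) ^ (k + card F) * ?h F)"
    using assms(1) fin by (intro sum.swap_restrict) simp_all
  also have "\<dots> = (\<Sum>F\<in>Pow I. (-1) ^ (k + card F) * real ((?n - card F) choose (?n - k)) * ?h F)"
  proof (intro sum.cong refl)
    fix F assume "F \<in> Pow I"
    moreover have "{G. G \<in> {G. G \<subseteq> I \<and> card G = k} \<and> F \<subseteq> G} = {G. F \<subseteq> G \<and> G \<subseteq> I \<and> card G = k}"
      by blast
    ultimately show "(\<Sum>G | G \<in> {G. G \<subseteq> I \<and> card G = k} \<and> F \<subseteq> G. (-1) ^ (k + card F) * ?h F) =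
        (-1) ^ (k + card F) * real ((?n - card F) choose (?n - k)) * ?h F"
      using assms(1,2) by (simp add: card_intermediate_sets)
  qed
  finally have faces: "(\<Sum>G | G \<subseteq> I \<and> card G = k. \<Sum>F\<in>Pow G. (-1) ^ (k + card F) * ?h F) =
      (\<Sum>F\<in>Pow I. (-1) ^ (k + card F) * real ((?n - card F) choose (?n - k)) * ?h F)" .
  have "Lancaster I X (Suc k) P A = (\<Sum>F\<in>Pow I. lancaster_coeff ?n k (card F) * ?h F -
      (-1) ^ (k + card F) * real ((?n - card F) choose (?n - k)) * ?h F)"
    using assms(1,2) P
    by (simp add: Lancaster_eq_sum_hybrid lancaster_coeff_Suc card_mono left_diff_distrib)
  then show ?thesis
    using assms(1,2) P by (simp add: faces Lancaster_eq_sum_hybrid sum_subtractf)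
qed

lemma Lancaster_zero_Suc:
  assumes "finite I" and "k < card I" and "discrete_prob (Pi\<^sub>E I X) P"
    and zero: "Lancaster I X k P = (\<lambda>_. 0)"
  shows "Lancaster I X (Suc k) P = (\<lambda>_. 0)"
proof
  fix A
  show "Lancaster I X (Suc k) P A = 0"
    unfolding Lancaster_Suc[OF assms(1-3)] zero
    using Lancaster_zero_imp_face_sum_zero[OF assms(1,3) _ _ zero] by simp
qed

section \<open>The top interaction of a product measure\<close>

text \<open>
  For \<open>k = n\<close> the polynomial in the coefficient is constant, and the sign \<open>(-1)^(n - card F)\<close> can be
  distributed over the coordinates outside \<open>F\<close>.
\<close>

lemma Lancaster_top_point:
  assumes "finite I" and P: "discrete_prob (Pi\<^sub>E I X) P" and x: "x \<in> Pi\<^sub>E I X"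
  shows "Lancaster I X (card I) P {x} =
         (\<Sum>F\<in>Pow I. marginal I X P F {restrict x F} * (\<Prod>i\<in>I - F. - coord_mass I X P x i))"
  unfolding Lancaster_eq_sum_hybrid[OF assms(1) order_refl P]
proof (intro sum.cong refl)
  fix F assume "F \<in> Pow I"
  then have F: "F \<subseteq> I"
    by blast
  let ?Q = "product_of_marginals I X P"
  let ?g = "\<lambda>x. marginal I X P F {restrict x F} * marginal I X ?Q (I - F) {restrict x (I - F)}"
  have "F \<union> (I - F) = I"
    using F by blast
  then have "hybrid I X P ?Q F {x} = (\<Sum>x' | x' = x \<and> ?g x \<noteq> 0. ?g x')"
    unfolding times_measure_def using x by (intro sum.cong) auto
  also have "\<dots> = ?g x"
    by (cases "?g x = 0") simp_all
  finally have hybrid: "hybrid I X P ?Q F {x} = ?g x" .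
  have "card (I - F) = card I - card F" "card F \<le> card I"
    using assms(1) F by (simp_all add: card_Diff_subset finite_subset card_mono)
  then have "lancaster_coeff (card I) (card I) (card F) = (-1) ^ card (I - F)"
    by (simp add: lancaster_coeff_def minus_one_power_iff)
  then show "lancaster_coeff (card I) (card I) (card F) * hybrid I X P ?Q F {x} =
      marginal I X P F {restrict x F} * (\<Prod>i\<in>I - F. - coord_mass I X P x i)"
    unfolding hybrid prod_uminus marginal_product_of_marginals[OF assms(1) P Diff_subset]
    by simp
qed

text \<open>
  Each summand of \<open>Lancaster_top_point\<close> is a product over the blocks \<open>B\<close> of terms in \<open>F \<inter> B\<close>: the
  first factor because \<open>P\<close> is a product over the partition, the second in any case. Exchanging
  sum and product gives the same formula within each block.
\<close>

lemma Lancaster_top_multiplicative_point: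
  assumes "finite I" and part: "partition_on I \<pi>" and P: "discrete_prob (Pi\<^sub>E I X) P"
    and prod: "P = partition_product I X P \<pi>" and x: "x \<in> Pi\<^sub>E I X"
  shows "Lancaster I X (card I) P {x} =
         (\<Prod>B\<in>\<pi>. Lancaster B X (card B) (marginal I X P B) {restrict x B})"
proof -
  let ?m = "\<lambda>F. marginal I X P F {restrict x F}"
  let ?p = "\<lambda>i. - coord_mass I X P x i"
  have fin: "finite \<pi>"
    using finite_elements[OF assms(1) part] .
  have block: "Lancaster B X (card B) (marginal I X P B) {restrict x B} =
      (\<Sum>H\<in>Pow B. ?m H * (\<Prod>i\<in>B - H. ?p i))" if B: "B \<in> \<pi>" for B
  proof -
    have BI: "B \<subseteq> I"
      by (rule partition_on_subset[OF part B])
    then have "restrict x B \<in> Pi\<^sub>E B X"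
      using x by auto
    then have "Lancaster B X (card B) (marginal I X P B) {restrict x B} =
        (\<Sum>H\<in>Pow B. marginal B X (marginal I X P B) H {restrict (restrict x B) H} *
          (\<Prod>i\<in>B - H. - coord_mass B X (marginal I X P B) (restrict x B) i))"
      by (rule Lancaster_top_point[OF partition_on_finite_block[OF assms(1) part B]
            discrete_prob_marginal[OF P BI]])
    also have "\<dots> = (\<Sum>H\<in>Pow B. ?m H * (\<Prod>i\<in>B - H. ?p i))"
      using BI by (intro sum.cong prod.cong arg_cong2[where f = "(*)"] refl)
        (simp_all add: marginal_marginal Int_absorb1)
    finally show ?thesis .
  qed
  have split: "(\<Prod>i\<in>I - F. ?p i) = (\<Prod>B\<in>\<pi>. \<Prod>i\<in>B - F \<inter> B. ?p i)" for F
  proof -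
    have union: "I - F = (\<Union>B\<in>\<pi>. B - F \<inter> B)"
      unfolding partition_onD1[OF part] by blast
    have "finite (B - F \<inter> B)" if "B \<in> \<pi>" for B
      using partition_on_finite_block[OF assms(1) part that] by simp
    moreover have "(B - F \<inter> B) \<inter> (B' - F \<inter> B') = {}" if "B \<in> \<pi>" "B' \<in> \<pi>" "B \<noteq> B'" for B B'
      using disjointD[OF partition_onD2[OF part] that] by blast
    ultimately show ?thesis
      unfolding union using fin by (intro prod.UNION_disjoint ballI impI)
  qed
  have marg: "?m F = (\<Prod>B\<in>\<pi>. ?m (F \<inter> B))" if "F \<subseteq> I" for F
    using arg_cong[where f = "\<lambda>R. marginal I X R F {restrict x F}", OF prod]
      marginal_partition_product[OF assms(1) part P that, of x] by (rule trans)
  have "Lancaster I X (card I) P {x} = (\<Sum>F\<in>Pow I. ?m F * (\<Prod>i\<in>I - F. ?p i))"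
    by (rule Lancaster_top_point[OF assms(1) P x])
  also have "\<dots> = (\<Sum>F\<in>Pow I. \<Prod>B\<in>\<pi>. ?m (F \<inter> B) * (\<Prod>i\<in>B - F \<inter> B. ?p i))"
    unfolding prod.distrib by (intro sum.cong arg_cong2[where f = "(*)"] refl marg split) blast
  also have "\<dots> = (\<Prod>B\<in>\<pi>. \<Sum>H\<in>Pow B. ?m H * (\<Prod>i\<in>B - H. ?p i))"
    by (rule prod_sum_Pow_partition[OF assms(1) part, symmetric])
  also have "\<dots> = (\<Prod>B\<in>\<pi>. Lancaster B X (card B) (marginal I X P B) {restrict x B})"
    by (intro prod.cong refl block[symmetric])
  finally show ?thesis .
qed

lemma Lancaster_top_multiplicative:
  assumes "finite I" and part: "partition_on I \<pi>" and P: "discrete_prob (Pi\<^sub>E I X) P"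
    and prod: "P = partition_product I X P \<pi>"
  shows "Lancaster I X (card I) P =
         Times_measure X \<pi> (\<lambda>B. Lancaster B X (card B) (marginal I X P B))"
proof
  fix A
  have U: "\<Union>\<pi> = I"
    using partition_onD1[OF part] by simp
  have "discrete_measure (Pi\<^sub>E I X) (Lancaster I X (card I) P)"
    unfolding Lancaster_def product_of_marginals_def[symmetric]
    by (rule discrete_measure_Lancaster2[OF assms(1) order_refl P
          discrete_prob_product_of_marginals[OF assms(1) P]])
  then have "Lancaster I X (card I) P A =
      (\<Sum>x | x \<in> A \<inter> Pi\<^sub>E I X \<and> Lancaster I X (card I) P {x} \<noteq> 0. Lancaster I X (card I) P {x})"
    by (rule discrete_measure_sum_points)
  also have "\<dots> = Times_measure X \<pi> (\<lambda>B. Lancaster B X (card B) (marginal I X P B)) A"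
    unfolding Times_measure_def U
    by (intro sum.cong Collect_cong) (auto simp: Lancaster_top_multiplicative_point[OF assms])
  finally show "Lancaster I X (card I) P A =
      Times_measure X \<pi> (\<lambda>B. Lancaster B X (card B) (marginal I X P B)) A" .
qed

section \<open>Properties of the generalized Lancaster interaction\<close>

theorem theorem3p6:
  fixes n :: nat and X :: "nat \<Rightarrow> 'a set"
  assumes "n \<ge> 1"
    and "\<And>i. i \<in> {1..n} \<Longrightarrow> X i \<noteq> {}"
  shows "(\<forall>k P Q. 1 \<le> k \<and> k \<le> n \<and>
            discrete_prob (Pi\<^sub>E {1..n} X) P \<and> discrete_prob (Pi\<^sub>E {1..n} X) Q \<longrightarrow>
            Lancaster2 {1..n} X k P Q \<in> M_space {1..n} X k)
       \<and> (\<forall>k P. 1 \<le> k \<and> k \<le> n - 1 \<and> discrete_prob (Pi\<^sub>E {1..n} X) P \<and>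
            Lancaster {1..n} X k P = (\<lambda>_. 0) \<longrightarrow>
            Lancaster {1..n} X (k + 1) P = (\<lambda>_. 0))
       \<and> (\<forall>P \<pi>. discrete_prob (Pi\<^sub>E {1..n} X) P \<and> partition_on {1..n} \<pi> \<and>
            P = partition_product {1..n} X P \<pi> \<longrightarrow>
            Lancaster {1..n} X n P =
              Times_measure X \<pi> (\<lambda>F. Lancaster F X (card F) (marginal {1..n} X P F)))"
proof (intro conjI allI impI)
  fix k P Q
  assume "1 \<le> k \<and> k \<le> n \<and> discrete_prob (Pi\<^sub>E {1..n} X) P \<and> discrete_prob (Pi\<^sub>E {1..n} X) Q"
  then show "Lancaster2 {1..n} X k P Q \<in> M_space {1..n} X k"
    by (intro Lancaster2_in_M_space) simp_all
next
  fix k P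
  assume k: "1 \<le> k \<and> k \<le> n - 1 \<and> discrete_prob (Pi\<^sub>E {1..n} X) P \<and> Lancaster {1..n} X k P = (\<lambda>_. 0)"
  then have "k < card {1..n}"
    by auto
  then show "Lancaster {1..n} X (k + 1) P = (\<lambda>_. 0)"
    using Lancaster_zero_Suc[of "{1..n}" k X P] k by simp
next
  fix P \<pi>
  assume P\<pi>: "discrete_prob (Pi\<^sub>E {1..n} X) P \<and> partition_on {1..n} \<pi> \<and> P = partition_product {1..n} X P \<pi>"
  note P = conjunct1[OF P\<pi>] and part = conjunct1[OF conjunct2[OF P\<pi>]]
    and prod = conjunct2[OF conjunct2[OF P\<pi>]]
  show "Lancaster {1..n} X n P =
      Times_measure X \<pi> (\<lambda>F. Lancaster F X (card F) (marginal {1..n} X P F))"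
    using Lancaster_top_multiplicative[OF finite_atLeastAtMost part P prod] by simp
qed

end
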